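(* Let $X$ be an orientable map with transition matrix $U$ and let $\tau$ be a positive integer. If $\tau$ is even, then $U^\tau=I$ if and only if $X$ is periodic at time $\tau$. If $\tau$ is odd, then $U^\tau=I$ if and only if $X$ is periodic at time $\tau$ and $|V|=|F|$. Furthermore, if $X$ is periodic at time $\tau$, then $U^{2\tau}=I$.
   Context: An orientable map $X$ is a 2-cell embedding of a finite connected multigraph (loops and parallel edges allowed) in a closed orientable surface, with vertex set $V$, edge set $E$ and face set $F$. Each edge gives rise to two arcs on opposite sides of it, pointing in opposite directions; each arc lies in a face and is oriented along the clockwise facial walk of that face. Let $\mathcal A$ be the set of arcs, $v(a)$ the tail vertex and $f(a)$ the face of arc $a$. Let $N\in\{0,1\}^{\mathcal A\times V}$ with $N(a,v)=1$ iff $v=v(a)$, $M\in\{0,1\}^{\mathcal A\times F}$ with $M(a,f)=1$ iff $f=f(a)$, $D=N^TN$, $\Delta=M^TM$, $\hat N=ND^{-1/2}$, $\hat M=M\Delta^{-1/2}$, $Q=\hat N\hat N^T$, $P=\hat M\hat M^T$, and $U=(2P-I)(2Q-I)$. The map $X$ is periodic at time $\tau$ if $U^\tau\hat N=\hat N$. *)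

theory Defs
  imports
    "HOL-Analysis.Analysis"
    "HOL-Combinatorics.Orbits"
    "Graph_Theory.Graph_Theory"
begin

text \<open>
  A 2-cell embedding of a connected multigraph in a closed orientable surface is encoded by its
  rotation system (Heffter--Edmonds). The edges are the pairs \<open>{a, rev a}\<close>; the arc \<open>a\<close> is the
  one that has its face on its right-hand side, so that it follows the clockwise facial walk of
  that face. \<open>rot\<close> sends an arc to the next arc, in anticlockwise order, with the same tail.
  A clockwise facial walk that arrives along \<open>a\<close> at the head of \<open>a\<close> therefore continues with
  \<open>rot (rev a)\<close>, and the faces correspond to the orbits of \<open>rot \<circ> rev\<close>; the type \<open>'f\<close> consists
  of names for these orbits.

  Vertex set, arc set and face set are the full types \<open>'v\<close>, \<open>'a\<close> and \<open>'f\<close>, so that they can index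
  matrices. As types are nonempty there is at least one edge; for the map without edges the
  degree matrix \<open>D\<close> is singular and \<open>D\<^sup>-\<^sup>1\<^sup>/\<^sup>2\<close> does not exist. Consequently, by connectedness, every
  vertex is the tail of some arc, in agreement with \<open>rot_cyclic\<close>.
\<close>
locale orientable_map = bidirected_digraph G rev
  for G :: "('v::finite, 'a::finite) pre_digraph"
    and rev :: "'a \<Rightarrow> 'a" +
  fixes rot :: "'a \<Rightarrow> 'a"
    and face :: "'a \<Rightarrow> 'f::finite"
  assumes verts_UNIV: "verts G = UNIV"
    and arcs_UNIV: "arcs G = UNIV"
    and connected_graph: "Digraph_Component.connected G"
    and rot_cyclic: "cyclic_on rot (out_arcs G v)"
    and face_eq_iff: "face a = face b \<longleftrightarrow> b \<in> orbit (rot \<circ> rev) a"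
    and face_surj: "surj face"

definition incidence :: "('a \<Rightarrow> 'b) \<Rightarrow> real^'b^'a" where
  "incidence h = (\<chi> a b. if h a = b then 1 else 0)"

text \<open>Meaningful only for diagonal matrices with positive diagonal entries.\<close>
definition diag_inv_sqrt :: "real^'n^'n \<Rightarrow> real^'n^'n" where
  "diag_inv_sqrt A = (\<chi> i j. if i = j then (A $ i $ i) powr (-1/2) else 0)"

text \<open>
  With \<open>h\<close> the tail map this is \<open>N D\<^sup>-\<^sup>1\<^sup>/\<^sup>2\<close> for \<open>D = N\<^sup>T N\<close>, with \<open>h\<close> the face map it is
  \<open>M \<Delta>\<^sup>-\<^sup>1\<^sup>/\<^sup>2\<close> for \<open>\<Delta> = M\<^sup>T M\<close>.
\<close>
definition norm_incidence :: "('a::finite \<Rightarrow> 'b::finite) \<Rightarrow> real^'b^'a" where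
  "norm_incidence h =
     incidence h ** diag_inv_sqrt (transpose (incidence h) ** incidence h)"

definition incidence_proj :: "('a::finite \<Rightarrow> 'b::finite) \<Rightarrow> real^'a^'a" where
  "incidence_proj h = norm_incidence h ** transpose (norm_incidence h)"

definition transition_matrix ::
  "('v::finite, 'a::finite) pre_digraph \<Rightarrow> ('a \<Rightarrow> 'f::finite) \<Rightarrow> real^'a^'a" where
  "transition_matrix G face =
     (2 *\<^sub>R incidence_proj face - mat 1) ** (2 *\<^sub>R incidence_proj (tail G) - mat 1)"

text \<open>The library's \<open>^\<close> on \<open>real^'n^'n\<close> would be the entrywise power.\<close>
primrec mat_power :: "real^'n^'n \<Rightarrow> nat \<Rightarrow> real^'n^'n" where
  "mat_power A 0 = mat 1"
| "mat_power A (Suc k) = A ** mat_power A k"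

definition periodic_at ::
  "('v::finite, 'a::finite) pre_digraph \<Rightarrow> ('a \<Rightarrow> 'f::finite) \<Rightarrow> nat \<Rightarrow> bool" where
  "periodic_at G face \<tau> \<longleftrightarrow>
     mat_power (transition_matrix G face) \<tau> ** norm_incidence (tail G) = norm_incidence (tail G)"

text \<open>\<open>D\<close> and \<open>\<Delta>\<close> are the diagonal matrices of degrees, and \<open>diag_inv_sqrt\<close> is their
  \<open>-1/2\<close>-th power.\<close>

lemma incidence_gram:
  "transpose (incidence h) ** incidence h =
     (\<chi> i j. if i = j then real (card {a. h a = i}) else 0)"
  for h :: "'a::finite \<Rightarrow> 'b::finite"
  by (auto simp: vec_eq_iff matrix_matrix_mult_def transpose_def incidence_def
      if_distrib[of "\<lambda>x. x * _"] sum.If_cases cong: if_cong intro!: sum.neutral)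

lemma diag_inv_sqrt_gram:
  fixes h :: "'a::finite \<Rightarrow> 'b::finite"
  assumes "surj h"
  defines "A \<equiv> transpose (incidence h) ** incidence h"
  shows "diag_inv_sqrt A ** diag_inv_sqrt A ** A = mat 1"
proof -
  have pos: "card {a. h a = i} > 0" for i
    using assms(1) by (auto simp: card_gt_0_iff) (metis surjD)
  have "x powr (-1/2) * x powr (-1/2) * x = 1" if "x > 0" for x :: real
    using that by (simp add: powr_add[symmetric] powr_minus field_simps)
  then show ?thesis
    using pos unfolding A_def incidence_gram
    by (simp add: vec_eq_iff matrix_matrix_mult_def diag_inv_sqrt_def mat_def
        if_distrib[of "\<lambda>x. x * _"] if_distrib[of "\<lambda>x. _ * x"] cong: if_cong)
qed

end

theory Submission
  imports Defs
begin

text \<open>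
  Write \<open>A = 2P - I\<close>, \<open>B = 2Q - I\<close>, \<open>U = AB\<close>, \<open>R = U\<^sup>\<tau>\<close> and \<open>Z = R - I\<close>. Periodicity means \<open>ZQ = 0\<close>,
  that is, \<open>RB = B + I - R\<close>. As \<open>A\<close> and \<open>B\<close> are symmetric involutions, \<open>BRB = R\<^sup>-\<^sup>1 = R\<^sup>T\<close>, so
  \<open>RB = BR\<^sup>T\<close>; comparing with the transposed equation \<open>BR\<^sup>T = B + I - R\<^sup>T\<close> gives \<open>R = R\<^sup>T = R\<^sup>-\<^sup>1\<close>,
  hence \<open>U\<^sup>2\<^sup>\<tau> = I\<close>. Now \<open>R\<close> commutes with \<open>A\<close> and \<open>B\<close>, so \<open>UZ = -AZ\<close> and \<open>U\<^sup>2Z = Z\<close>. For even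
  \<open>\<tau>\<close> this gives \<open>RZ = Z\<close>, while \<open>RZ = -Z\<close> because \<open>R\<^sup>2 = I\<close>; so \<open>Z = 0\<close>. For odd \<open>\<tau>\<close> it gives
  \<open>AZ = Z\<close>; since \<open>AR\<close> is conjugate to \<open>B\<close>, taking traces yields \<open>tr Z = tr B - tr A = 2(|V| - |F|)\<close>, and the
  orthogonal matrix \<open>R\<close> is the identity iff \<open>tr Z = 0\<close>.
\<close>

section \<open>Matrix algebra and traces\<close>

lemma matrix_sub_ldistrib: "A ** (B - C) = A ** B - A ** C"
  for A :: "real^'n^'m" and B C :: "real^'k^'n"
  by (simp add: matrix_matrix_mult_def vec_eq_iff right_diff_distrib sum_subtractf)

lemma matrix_sub_rdistrib: "(B - C) ** A = B ** A - C ** A"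
  for A :: "real^'k^'n" and B C :: "real^'n^'m"
  by (simp add: matrix_matrix_mult_def vec_eq_iff left_diff_distrib sum_subtractf)

lemma transpose_diff: "transpose (A - B) = transpose A - transpose B"
  for A B :: "real^'n^'m"
  by (simp add: transpose_def vec_eq_iff)

lemma transpose_add: "transpose (A + B) = transpose A + transpose B"
  for A B :: "real^'n^'m"
  by (simp add: transpose_def vec_eq_iff)

lemma trace_scaleR: "trace (c *\<^sub>R A) = c * trace A"
  for A :: "real^'n^'n"
  by (simp add: trace_def sum_distrib_left)

lemma trace_mat_1: "trace (mat 1 :: real^'n^'n) = real CARD('n)"
  by (simp add: trace_def mat_def)

lemma trace_transpose_mult_self_eq_0_iff:
  "trace (transpose X ** X) = 0 \<longleftrightarrow> X = 0" for X :: "real^'n^'m"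
  by (simp add: trace_def matrix_matrix_mult_def transpose_def sum_nonneg_eq_0_iff
      sum_nonneg vec_eq_iff) blast

text \<open>The squared Frobenius norm of \<open>R - mat 1\<close> is
  \<open>trace (2I - R - transpose R)\<close>, i.e. twice the difference of the two traces.\<close>

lemma orthogonal_eq_mat_1_iff_trace:
  fixes R :: "real^'n^'n"
  assumes "transpose R ** R = mat 1"
  shows "R = mat 1 \<longleftrightarrow> trace R = real CARD('n)"
proof
  assume tr: "trace R = real CARD('n)"
  have "trace (transpose R) = trace R"
    by (simp add: trace_def transpose_def)
  moreover have "transpose (R - mat 1) ** (R - mat 1) = mat 1 - transpose R - (R - mat 1)"
    by (simp add: transpose_diff matrix_sub_ldistrib matrix_sub_rdistrib assms)
  ultimately have "trace (transpose (R - mat 1) ** (R - mat 1)) = 0"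
    by (simp only: trace_sub trace_mat_1 tr)
  then show "R = mat 1"
    by (simp add: trace_transpose_mult_self_eq_0_iff)
qed (simp add: trace_mat_1)

section \<open>Powers of matrices\<close>

lemma mat_power_add: "mat_power A (m + n) = mat_power A m ** mat_power A n"
  by (induction m) (simp_all add: matrix_mul_assoc)

lemma mat_power_Suc_right: "mat_power A (Suc n) = mat_power A n ** A"
  using mat_power_add[of A n 1] by simp

lemma transpose_mat_power: "transpose (mat_power A n) = mat_power (transpose A) n"
  for A :: "real^'n^'n"
proof (induction n)
  case (Suc n)
  then show ?case
    unfolding mat_power_Suc_right[of "transpose A"] by (simp add: matrix_transpose_mul)
qed simp

lemma mat_power_inverse:
  assumes "A ** B = mat 1"
  shows "mat_power A n ** mat_power B n = mat 1"
proof (induction n)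
  case (Suc n)
  have "mat_power A (Suc n) ** mat_power B (Suc n)
      = A ** (mat_power A n ** mat_power B n) ** B"
    unfolding mat_power_Suc_right[of B] by (simp add: matrix_mul_assoc)
  then show ?case
    using Suc.IH assms by simp
qed simp

text \<open>For involutions \<open>A\<close> and \<open>B\<close> this says that conjugation by
  either factor inverts the powers of \<open>A ** B\<close>.\<close>

lemma mat_power_mult_shift:
  "mat_power (A ** B) n ** A = A ** mat_power (B ** A) n"
proof (induction n)
  case (Suc n)
  have "mat_power (A ** B) (Suc n) ** A = A ** B ** (mat_power (A ** B) n ** A)"
    by (simp add: matrix_mul_assoc)
  then show ?case
    unfolding Suc.IH by (simp add: matrix_mul_assoc)
qed simp

section \<open>Products of two symmetric involutions\<close>

locale symmetric_involutions =
  fixes A B :: "real^'n^'n"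
  assumes sym_A: "transpose A = A" and sym_B: "transpose B = B"
    and inv_A: "A ** A = mat 1" and inv_B: "B ** B = mat 1"
begin

lemma AB_BA: "A ** B ** (B ** A) = mat 1"
  by (metis inv_A inv_B matrix_mul_assoc matrix_mul_rid)

lemma BA_AB: "B ** A ** (A ** B) = mat 1"
  by (metis inv_A inv_B matrix_mul_assoc matrix_mul_rid)

lemma transpose_power: "transpose (mat_power (A ** B) n) = mat_power (B ** A) n"
  by (simp add: transpose_mat_power matrix_transpose_mul sym_A sym_B)

text \<open>Put \<open>S = U^k\<close> for \<open>n = 2k + 1\<close>. Cancelling
  \<open>A ** A\<close> leaves \<open>B ** S ** S\<close>, and \<open>B ** S = T ** B\<close> with
  \<open>T\<close> the inverse of \<open>S\<close>, so the product is the conjugate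
  \<open>T ** B ** S\<close> of \<open>B\<close>.\<close>

lemma trace_odd_power:
  assumes "odd n"
  shows "trace (A ** mat_power (A ** B) n) = trace B"
proof -
  obtain k where n: "n = Suc (k + k)"
    using assms by (auto elim!: oddE simp: mult_2)
  let ?S = "mat_power (A ** B) k" and ?T = "mat_power (B ** A) k"
  have "A ** mat_power (A ** B) n = A ** A ** (B ** ?S) ** ?S"
    by (simp add: n mat_power_add matrix_mul_assoc)
  also have "B ** ?S = ?T ** B"
    by (simp add: mat_power_mult_shift)
  finally have "trace (A ** mat_power (A ** B) n) = trace (?T ** (B ** ?S))"
    by (simp add: inv_A matrix_mul_assoc)
  also have "\<dots> = trace (B ** (?S ** ?T))"
    by (metis trace_mul_sym matrix_mul_assoc)
  finally show ?thesis
    by (simp add: mat_power_inverse[OF AB_BA])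
qed

text \<open>The hypothesis on \<open>n\<close> says that \<open>U\<^sup>n\<close> fixes the range of the projection \<open>(B + I)/2\<close>.\<close>

context
  fixes n :: nat and R :: "real^'n^'n"
  defines "R \<equiv> mat_power (A ** B) n"
  assumes periodic: "R ** B = B + mat 1 - R"
begin

lemma symmetric_R: "transpose R = R"
proof -
  have "transpose (R ** B) = transpose (B + mat 1 - R)"
    by (simp only: periodic)
  then have "B ** transpose R = B + mat 1 - transpose R"
    by (simp add: matrix_transpose_mul transpose_diff transpose_add sym_B)
  moreover have "B ** transpose R = R ** B"
  proof -
    have "R ** B = B ** (B ** R) ** B"
      by (simp add: matrix_mul_assoc inv_B)
    also have "B ** R = transpose R ** B"
      unfolding R_def transpose_power by (simp add: mat_power_mult_shift)
    finally show ?thesis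
      by (metis inv_B matrix_mul_assoc matrix_mul_rid)
  qed
  ultimately show ?thesis
    using periodic by (simp add: algebra_simps)
qed

lemma R_squared: "R ** R = mat 1"
proof -
  have "transpose R ** R = mat 1"
    unfolding R_def transpose_power by (rule mat_power_inverse[OF BA_AB])
  then show ?thesis
    by (simp add: symmetric_R)
qed

text \<open>The shift identity gives \<open>R ** A = A ** transpose R\<close>, and symmetry of
  \<open>R\<close> removes the transpose.\<close>

lemma R_commutes_A: "A ** R = R ** A"
  using mat_power_mult_shift[of A B n] symmetric_R
  unfolding R_def transpose_power by simp

lemma B_R: "B ** R = B + mat 1 - R"
  using arg_cong[OF periodic, of transpose]
  by (simp add: matrix_transpose_mul transpose_diff transpose_add sym_B symmetric_R)

text \<open>Periodicity and symmetry of \<open>R\<close> give \<open>BZ = -Z\<close>; the right-hand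
  side is \<open>-AZ\<close>.\<close>

lemma U_Z: "A ** B ** (R - mat 1) = A - A ** R"
proof -
  have "A ** B ** (R - mat 1) = A ** (B ** R - B)"
    by (simp add: matrix_sub_ldistrib matrix_mul_assoc)
  then show ?thesis
    by (simp add: B_R matrix_sub_ldistrib)
qed

text \<open>Since \<open>Z\<close> commutes with \<open>A\<close> and \<open>BZ = -Z\<close>, one
  gets \<open>U(-AZ) = -A(BZ)A = AZA = Z\<close>.\<close>

lemma U_U_Z: "A ** B ** (A ** B ** (R - mat 1)) = R - mat 1"
proof -
  have "A ** B ** (A - A ** R) = A ** (B - B ** R) ** A"
    by (simp add: R_commutes_A matrix_sub_ldistrib matrix_sub_rdistrib matrix_mul_assoc)
  also have "\<dots> = (A ** R - A) ** A"
    by (simp add: B_R matrix_sub_ldistrib)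
  also have "\<dots> = R - mat 1"
    unfolding R_commutes_A
    by (simp add: matrix_sub_rdistrib inv_A flip: matrix_mul_assoc)
  finally show ?thesis
    by (simp add: U_Z)
qed

lemma even_power_Z: "mat_power (A ** B) (k + k) ** (R - mat 1) = R - mat 1"
proof (induction k)
  case (Suc k)
  have "mat_power (A ** B) (Suc k + Suc k) ** (R - mat 1)
      = A ** B ** (A ** B ** (mat_power (A ** B) (k + k) ** (R - mat 1)))"
    by (simp add: matrix_mul_assoc)
  then show ?case
    by (simp only: Suc.IH U_U_Z)
qed simp

lemma R_Z: "R ** (R - mat 1) = mat 1 - R"
  by (simp add: matrix_sub_ldistrib R_squared)

lemma periodic_even:
  assumes "even n"
  shows "R = mat 1"
proof -
  obtain k where "n = k + k"
    using assms by (auto elim!: evenE simp: mult_2)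
  then have "mat 1 - R = R - mat 1"
    using even_power_Z[of k] R_Z by (simp add: R_def)
  then have "2 *\<^sub>R R = 2 *\<^sub>R mat 1"
    by (simp add: scaleR_2 algebra_simps)
  then show ?thesis by simp
qed

lemma periodic_odd:
  assumes "odd n"
  shows "R = mat 1 \<longleftrightarrow> trace A = trace B"
proof -
  obtain k where n: "n = Suc (k + k)"
    using assms by (auto elim!: oddE simp: mult_2)
  \<comment> \<open>The even power fixes \<open>Z\<close>, so that \<open>RZ\<close> reduces to
    \<open>UZ\<close>.\<close>
  have "R ** (R - mat 1) = A ** B ** (mat_power (A ** B) (k + k) ** (R - mat 1))"
    by (simp add: R_def n matrix_mul_assoc)
  then have "mat 1 - R = A - A ** R"
    by (simp only: even_power_Z U_Z R_Z)
  then have "trace (mat 1 - R) = trace (A - A ** R)"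
    by simp
  then have "real CARD('n) - trace R = trace A - trace B"
    using trace_odd_power[OF assms] by (simp add: trace_sub trace_mat_1 R_def)
  moreover have "R = mat 1 \<longleftrightarrow> trace R = real CARD('n)"
    by (rule orthogonal_eq_mat_1_iff_trace) (simp add: symmetric_R R_squared)
  ultimately show ?thesis by auto
qed

end

end

section \<open>Projections from normalized incidence matrices\<close>

lemma norm_incidence_gram:
  fixes h :: "'a::finite \<Rightarrow> 'b::finite"
  assumes "surj h"
  shows "transpose (norm_incidence h) ** norm_incidence h = mat 1"
proof -
  let ?X = "incidence h"
  let ?S = "diag_inv_sqrt (transpose ?X ** ?X)"
  have "transpose ?S = ?S"
    by (simp add: transpose_def diag_inv_sqrt_def vec_eq_iff)
  then have "transpose (norm_incidence h) ** norm_incidence h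
      = ?S ** (transpose ?X ** ?X) ** ?S"
    by (simp add: norm_incidence_def matrix_transpose_mul matrix_mul_assoc)
  \<comment> \<open>A one-sided inverse of a square matrix is two-sided, which moves one factor
    \<open>?S\<close> to the right end.\<close>
  moreover have "?S ** (?S ** (transpose ?X ** ?X)) = mat 1"
    using diag_inv_sqrt_gram[OF assms] by (simp add: matrix_mul_assoc)
  ultimately show ?thesis
    by (simp add: matrix_left_right_inverse)
qed

lemma incidence_proj_mult_norm_incidence:
  assumes "surj h"
  shows "incidence_proj h ** norm_incidence h = norm_incidence h"
  by (simp add: incidence_proj_def norm_incidence_gram[OF assms] flip: matrix_mul_assoc)

lemma incidence_proj_idem:
  assumes "surj h"
  shows "incidence_proj h ** incidence_proj h = incidence_proj h"
  using incidence_proj_mult_norm_incidence[OF assms]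
  by (metis incidence_proj_def matrix_mul_assoc)

lemma transpose_incidence_proj: "transpose (incidence_proj h) = incidence_proj h"
  by (simp add: incidence_proj_def matrix_transpose_mul)

text \<open>Cyclicity of the trace turns the projection into the Gram matrix, an identity matrix
  indexed by \<open>'b\<close>.\<close>

lemma trace_incidence_proj:
  fixes h :: "'a::finite \<Rightarrow> 'b::finite"
  assumes "surj h"
  shows "trace (incidence_proj h) = real CARD('b)"
  using norm_incidence_gram[OF assms]
  by (simp add: incidence_proj_def trace_mul_sym[of "norm_incidence h"] trace_mat_1)

lemma projection_reflection_involution:
  fixes P :: "real^'n^'n"
  assumes "P ** P = P"
  shows "(2 *\<^sub>R P - mat 1) ** (2 *\<^sub>R P - mat 1) = mat 1"
  by (simp add: matrix_sub_ldistrib matrix_sub_rdistrib assms matrix_scalar_ac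
      flip: scalar_matrix_assoc) (simp only: scaleR_2 mult_2)

text \<open>Replaces the rectangular normalized incidence matrix by the square projection
  \<open>Q\<close>, which has the same range, so that periodicity can be stated in terms of
  \<open>A\<close> and \<open>B\<close>.\<close>

lemma periodic_at_iff:
  fixes G :: "('v::finite, 'a::finite) pre_digraph" and face :: "'a \<Rightarrow> 'f::finite"
  assumes "surj (tail G)"
  defines "Q \<equiv> incidence_proj (tail G)" and "U \<equiv> transition_matrix G face"
  shows "periodic_at G face \<tau> \<longleftrightarrow> mat_power U \<tau> ** Q = Q"
  unfolding periodic_at_def Q_def U_def
  by (metis incidence_proj_def incidence_proj_mult_norm_incidence[OF assms(1)] matrix_mul_assoc)

lemma (in orientable_map) surj_tail: "surj (tail G)"
proof (rule surjI)
  fix v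
  \<comment> \<open>The set underlying a cyclic permutation is an orbit, hence nonempty.\<close>
  have "out_arcs G v \<noteq> {}"
    using rot_cyclic[of v] by (simp add: cyclic_on_alldef)
  then show "tail G (SOME a. tail G a = v) = v"
    by (auto simp: out_arcs_def intro: someI)
qed

theorem theorem5p2:
  fixes G :: "('v::finite, 'a::finite) pre_digraph"
    and rev rot :: "'a \<Rightarrow> 'a"
    and face :: "'a \<Rightarrow> 'f::finite"
    and \<tau> :: nat
  assumes "orientable_map G rev rot face"
    and "\<tau> > 0"
  shows "(even \<tau> \<longrightarrow>
      (mat_power (transition_matrix G face) \<tau> = mat 1 \<longleftrightarrow> periodic_at G face \<tau>)) \<and>
    (odd \<tau> \<longrightarrow>
      (mat_power (transition_matrix G face) \<tau> = mat 1 \<longleftrightarrow>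
        periodic_at G face \<tau> \<and> CARD('v) = CARD('f))) \<and>
    (periodic_at G face \<tau> \<longrightarrow>
      mat_power (transition_matrix G face) (2 * \<tau>) = mat 1)"
proof -
  interpret orientable_map G rev rot face by fact
  define P where "P = incidence_proj face"
  define Q where "Q = incidence_proj (tail G)"
  define A where "A = 2 *\<^sub>R P - mat 1"
  define B where "B = 2 *\<^sub>R Q - mat 1"
  have U: "transition_matrix G face = A ** B"
    by (simp add: transition_matrix_def A_def B_def P_def Q_def)
  interpret symmetric_involutions A B
    by unfold_locales
      (simp_all add: A_def B_def P_def Q_def transpose_diff transpose_scalar
        transpose_incidence_proj projection_reflection_involution incidence_proj_idem
        face_surj surj_tail)
  \<comment> \<open>The traces are \<open>2|F|\<close> and \<open>2|V|\<close>, each minus the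
    number of arcs.\<close>
  have traces: "trace A = trace B \<longleftrightarrow> CARD('v) = CARD('f)"
    by (auto simp: A_def B_def P_def Q_def trace_sub trace_scaleR trace_incidence_proj
        face_surj surj_tail)
  let ?R = "mat_power (A ** B) \<tau>"
  have fixes_range: "?R ** B = B + mat 1 - ?R" if "periodic_at G face \<tau>"
  proof -
    have "?R ** Q = Q"
      using that by (simp add: periodic_at_iff surj_tail Q_def U)
    \<comment> \<open>Here \<open>RB = 2RQ - R = 2Q - R\<close>, and
      \<open>2Q = B + I\<close>.\<close>
    then show ?thesis
      by (simp add: B_def matrix_sub_ldistrib matrix_scalar_ac flip: scalar_matrix_assoc)
  qed
  have "periodic_at G face \<tau>" if "?R = mat 1"
    using that by (simp add: periodic_at_def U)
  then show ?thesis
    unfolding U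
    using fixes_range periodic_even periodic_odd R_squared traces
    by (auto simp: mult_2 mat_power_add)
qed

end
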